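(* There exist infinitely many rational numbers having at least $37$ exceptional points.
   Context: For a nonzero algebraic number $\alpha$ with minimal polynomial $a\prod_{i=1}^d(z-\alpha_i)$ over $\mathbb Z$, the Mahler measure is $m(\alpha)=\log|a|+\sum_{i=1}^d\log\max\{1,|\alpha_i|\}$. Let $\mathcal P(\alpha)$ be the set of all finite tuples $(\alpha_1,\ldots,\alpha_N)$ of nonzero algebraic numbers ($N\in\mathbb N$) with $\alpha=\prod_i\alpha_i$. For $t>0$, $m_t(\alpha)=\inf\{(\sum_{i=1}^N m(\alpha_i)^t)^{1/t}:(\alpha_1,\ldots,\alpha_N)\in\mathcal P(\alpha)\}$. A real number $t>0$ is an exceptional point for $\alpha$ if for every neighborhood $U$ of $t$ and every $(\alpha_1,\ldots,\alpha_N)\in\mathcal P(\alpha)$ there exists $s\in U$ with $m_s(\alpha)<(\sum_{i=1}^N m(\alpha_i)^s)^{1/s}$. *)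

theory Defs
  imports Complex_Main "HOL-Computational_Algebra.Computational_Algebra"
begin

text \<open>
  The minimal polynomial over the integers of an algebraic number: irreducible in the ring of
  integer polynomials (so in particular primitive), normalised to positive leading coefficient.
  It is well defined by \<open>int_min_poly_ex1\<close> below, but unspecified for transcendental numbers.
\<close>

definition is_int_min_poly :: "complex \<Rightarrow> int poly \<Rightarrow> bool" where
  "is_int_min_poly \<alpha> p \<longleftrightarrow>
     irreducible p \<and> lead_coeff p > 0 \<and> poly (map_poly of_int p) \<alpha> = 0"

definition int_min_poly :: "complex \<Rightarrow> int poly" where
  "int_min_poly \<alpha> = (THE p. is_int_min_poly \<alpha> p)"

text \<open>The sum ranges over the multiset of complex roots.\<close>

definition log_mahler :: "complex \<Rightarrow> real" where
  "log_mahler \<alpha> =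
     (let p = int_min_poly \<alpha>
      in ln (real_of_int \<bar>lead_coeff p\<bar>) +
         (\<Sum>z\<in>#proots (map_poly of_int p :: complex poly). ln (max 1 (cmod z))))"

definition alg_factorizations :: "complex \<Rightarrow> complex list set" where
  "alg_factorizations \<alpha> =
     {xs. xs \<noteq> [] \<and> (\<forall>x\<in>set xs. algebraic x \<and> x \<noteq> 0) \<and> prod_list xs = \<alpha>}"

text \<open>
  Only meant for \<open>t > 0\<close>; there \<open>0 powr t = 0\<close> is the usual value of the power.
\<close>

definition tuple_mahler :: "real \<Rightarrow> complex list \<Rightarrow> real" where
  "tuple_mahler t xs = (\<Sum>x\<leftarrow>xs. log_mahler x powr t) powr (1 / t)"

definition metric_mahler :: "real \<Rightarrow> complex \<Rightarrow> real" where
  "metric_mahler t \<alpha> = (INF xs\<in>alg_factorizations \<alpha>. tuple_mahler t xs)"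

text \<open>
  The functions of \<open>t\<close> above are considered on the positive reals only, so neighbourhoods
  are taken there.
\<close>

definition exceptional_point :: "complex \<Rightarrow> real \<Rightarrow> bool" where
  "exceptional_point \<alpha> t \<longleftrightarrow>
     t > 0 \<and>
     (\<forall>U. open U \<and> t \<in> U \<and> U \<subseteq> {0<..} \<longrightarrow>
        (\<forall>xs\<in>alg_factorizations \<alpha>. \<exists>s\<in>U. metric_mahler s \<alpha> < tuple_mahler s xs))"

lemma int_min_poly_ex1:
  assumes "algebraic \<alpha>"
  shows "\<exists>!p. is_int_min_poly \<alpha> p"
proof -
  let ?r = "\<lambda>p :: int poly. poly (map_poly of_int p) \<alpha>"
  have hom_mult: "?r (p * q) = ?r p * ?r q" for p q
  proof -
    have "map_poly of_int (p * q) = (map_poly of_int p * map_poly of_int q :: complex poly)"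
      by (rule poly_eqI) (simp add: coeff_map_poly coeff_mult)
    thus ?thesis by simp
  qed
  have hom_add: "?r (p + q) = ?r p + ?r q" for p q
  proof -
    have "map_poly of_int (p + q) = (map_poly of_int p + map_poly of_int q :: complex poly)"
      by (rule poly_eqI) (simp add: coeff_map_poly)
    thus ?thesis by simp
  qed
  have hom_const: "?r [:c:] = of_int c" for c
    by (simp add: map_poly_pCons)
  have hom_smult: "?r (smult c p) = of_int c * ?r p" for c p
    using hom_mult[of "[:c:]" p] hom_const[of c] by simp
  obtain f0 where f0: "f0 \<noteq> 0" "?r f0 = 0"
  proof -
    from assms obtain p where p: "\<And>i. coeff p i \<in> \<int>" "p \<noteq> 0" "poly p \<alpha> = 0"
      by (erule algebraicE)
    define q where "q = map_poly (\<lambda>c. \<lfloor>Re c\<rfloor>) p"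
    have "map_poly of_int q = p"
    proof (rule poly_eqI)
      fix n
      obtain k where "coeff p n = of_int k" using p(1)[of n] by (elim Ints_cases)
      thus "coeff (map_poly of_int q) n = coeff p n"
        by (simp add: q_def coeff_map_poly)
    qed
    thus thesis using p by (intro that[of q]) auto
  qed
  define d where "d = (LEAST n. \<exists>f. f \<noteq> 0 \<and> ?r f = 0 \<and> degree f = n)"
  have "\<exists>f. f \<noteq> 0 \<and> ?r f = 0 \<and> degree f = d"
    unfolding d_def by (rule LeastI_ex) (use f0 in blast)
  then obtain g where g: "g \<noteq> 0" "?r g = 0" "degree g = d" by blast
  have least: "d \<le> degree f" if "f \<noteq> 0" "?r f = 0" for f
    unfolding d_def by (rule Least_le) (use that in blast)
  define m where "m = smult (sgn (lead_coeff g)) (primitive_part g)"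
  have s: "sgn (lead_coeff g) * sgn (lead_coeff g) = 1"
    using g(1) by (simp add: sgn_if)
  have g_eq: "g = smult (content g) (primitive_part g)"
    by simp
  have "of_int (content g) * ?r (primitive_part g) = 0"
    using g(2) g_eq hom_smult by metis
  hence m_root: "?r m = 0"
    using g(1) by (simp add: m_def hom_smult)
  have m_deg: "degree m = d"
    using g s by (auto simp: m_def sgn_if)
  have m_content: "content m = 1"
    using g(1) s by (auto simp: m_def content_smult sgn_if)
  have m0: "m \<noteq> 0" using m_content by auto
  have m_pos: "lead_coeff m > 0"
  proof -
    have "lead_coeff g = content g * lead_coeff (primitive_part g)"
      using g_eq by (metis lead_coeff_smult)
    moreover have "content g > 0"
    proof -
      have "\<bar>content g\<bar> = content g"
        using normalize_content[of g] by (simp only: normalize_int_def)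
      moreover have "content g \<noteq> 0" using g(1) by simp
      ultimately show ?thesis by linarith
    qed
    ultimately have "sgn (lead_coeff g) = sgn (lead_coeff (primitive_part g))"
      by (simp add: sgn_mult)
    thus ?thesis using g(1) by (auto simp: m_def sgn_if split: if_splits)
  qed
  have d_pos: "d > 0"
  proof (rule ccontr)
    assume "\<not> d > 0"
    then obtain c where "m = [:c:]" using m_deg by (metis degree_eq_zeroE neq0_conv)
    thus False using m_root m0 hom_const[of c] by simp
  qed
  have m_dvd: "m dvd f" if f: "?r f = 0" for f
  proof -
    obtain q r where qr: "pseudo_divmod f m = (q, r)" by (cases "pseudo_divmod f m")
    define c where "c = lead_coeff m ^ (Suc (degree f) - degree m)"
    have c0: "c \<noteq> 0" using m0 by (simp add: c_def)
    have eq: "smult c f = m * q + r" and r: "r = 0 \<or> degree r < degree m"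
      using pseudo_divmod[OF m0 qr] by (auto simp: c_def)
    have "?r r = 0"
      using arg_cong[OF eq, of ?r] f m_root by (simp add: hom_smult hom_add hom_mult)
    hence "r = 0" using r least[of r] m_deg by (metis not_less)
    hence eq: "smult c f = m * q" using eq by simp
    have "normalize c * content f = content q"
      using arg_cong[OF eq, of content] m_content by (simp add: content_smult content_mult)
    hence "normalize c dvd content q" by (intro dvdI[of _ _ "content f"]) simp
    hence "c dvd content q" by (simp only: normalize_dvd_iff)
    hence "[:c:] dvd q" by (simp only: const_poly_dvd_iff_dvd_content)
    then obtain q' where "q = [:c:] * q'" by (rule dvdE)
    hence "q = smult c q'" by simp
    hence "[:c:] * f = [:c:] * (m * q')" using eq by simp
    moreover have "[:c:] \<noteq> 0" using c0 by simp
    ultimately have "f = m * q'" using mult_cancel_left[of "[:c:]" f "m * q'"] by blast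
    thus ?thesis by simp
  qed
  have m_irr: "irreducible m"
  proof (rule irreducibleI)
    show "m \<noteq> 0" by (fact m0)
    show "\<not> is_unit m" using d_pos m_deg by (auto simp: is_unit_poly_iff)
    fix a b assume ab: "m = a * b"
    have "is_unit v" if uv: "m = u * v" "?r u = 0" for u v
    proof -
      obtain w where w: "u = m * w" using m_dvd[OF uv(2)] by blast
      have "m * 1 = m * (w * v)"
        using trans[OF uv(1) arg_cong[OF w, of "\<lambda>z. z * v"]] by (simp add: mult.assoc)
      hence "1 = w * v" using m0 mult_cancel_left[of m 1 "w * v"] by blast
      thus ?thesis by (intro dvdI[of _ _ w]) (simp add: mult.commute)
    qed
    moreover have "?r a = 0 \<or> ?r b = 0" using m_root ab by (simp add: hom_mult)
    ultimately show "is_unit a \<or> is_unit b" using ab trans[OF ab mult.commute] by blast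
  qed
  show ?thesis
  proof (rule ex1I[of _ m])
    show "is_int_min_poly \<alpha> m"
      using m_irr m_pos m_root by (simp add: is_int_min_poly_def)
    fix q assume q: "is_int_min_poly \<alpha> q"
    then obtain w where w: "q = m * w" using m_dvd by (auto simp: is_int_min_poly_def)
    have "is_unit w"
      using q irreducibleD[of q m w] w irreducible_not_unit[OF m_irr]
      by (auto simp: is_int_min_poly_def)
    then obtain c where c: "w = [:c:]" "is_unit c" by (auto simp: is_unit_poly_iff)
    hence "c = 1 \<or> c = -1" by auto
    moreover have "lead_coeff q = c * lead_coeff m" using w c by simp
    ultimately have "c = 1" using q m_pos by (auto simp: is_int_min_poly_def)
    thus "q = m" using w c by simp
  qed
qed

end

theory Submission
  imports Defs "HOL-Complex_Analysis.Conformal_Mappings"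
begin

text \<open>
  Any factorization of a fraction \<open>r/s\<close> in lowest terms into algebraic numbers can be replaced by one
  into fractions \<open>u/v\<close> with \<open>ln (max u v)\<close> at most the Mahler measure of the corresponding factor.
  Take \<open>r = 3^a\<close> and \<open>s = 5^n\<close> with \<open>a = \<lfloor>n ln 5 / ln 3\<rfloor>\<close>, and let \<open>T = (ln r + ln s) / 2\<close>; then
  \<open>\<Sum> ln (max u v) \<ge> T\<close> always.  If \<open>\<Sum> m(x)^e \<le> 2T\<close> for some \<open>e > 1\<close>, then a definite
  part of the weight \<open>T\<close> sits on fractions of bounded height, and each of these wastes a definite
  proportion since \<open>u \<noteq> v\<close>; hence \<open>\<Sum> m(x)^q \<ge> (1 + \<delta>) T\<close> for all \<open>q \<ge> 1\<close>, with \<open>\<delta>\<close>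
  depending only on \<open>e\<close>.  On the other hand, factorizations into copies of one large fraction of the
  same shape and a few factors 3 achieve \<open>\<Sum> m(x)^d < (1 + \<delta>) T\<close> for some \<open>d\<close> close to 1.  So
  no tuple is optimal at both \<open>d\<close> and \<open>e\<close>, which forces an exceptional point between them.
  Iterating towards \<open>t = 1\<close> gives arbitrarily many exceptional points.
\<close>

subsection \<open>Products of roots of integer polynomials\<close>

interpretation int_mod: module "\<lambda>(n::int) (z::complex). of_int n * z"
  by unfold_locales (simp_all add: algebra_simps)

text \<open>
  Algebraic integers have this property, and unlike their definition by monic polynomials it is
  visibly stable under products.
\<close>

definition powers_fg :: "complex \<Rightarrow> bool" where
  "powers_fg x \<longleftrightarrow> (\<exists>F. finite F \<and> (\<forall>k. x ^ k \<in> int_mod.span F))"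

lemma powers_fg_1: "powers_fg 1"
  unfolding powers_fg_def by (intro exI[of _ "{1}"]) (simp add: int_mod.span_base)

text \<open>With \<open>int_mod.span_minimal\<close> this reduces a claim about multiplication on a
  whole span to its generators.\<close>

lemma subspace_mult_vimage:
  assumes "int_mod.subspace M"
  shows "int_mod.subspace {z. y * z \<in> M}"
proof (rule int_mod.subspaceI)
  fix c z assume "z \<in> {z. y * z \<in> M}"
  hence "of_int c * (y * z) \<in> M" using int_mod.subspace_scale[OF assms] by simp
  thus "of_int c * z \<in> {z. y * z \<in> M}" by (simp add: mult.left_commute)
qed (use int_mod.subspace_0[OF assms] int_mod.subspace_add[OF assms] in \<open>simp_all add: distrib_left\<close>)

lemma int_span_mult:
  assumes "x \<in> int_mod.span F" "y \<in> int_mod.span G"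
  shows "x * y \<in> int_mod.span ((\<lambda>(f, g). f * g) ` (F \<times> G))"
    (is "_ \<in> int_mod.span ?H")
proof -
  have left: "f * y \<in> int_mod.span ?H" if "f \<in> F" for f
  proof -
    have "int_mod.subspace {y. f * y \<in> int_mod.span ?H}"
      by (intro subspace_mult_vimage int_mod.subspace_span)
    moreover have "G \<subseteq> {y. f * y \<in> int_mod.span ?H}"
      using that by (auto intro: int_mod.span_base)
    ultimately show ?thesis using int_mod.span_minimal assms(2) by blast
  qed
  have "int_mod.subspace {x. y * x \<in> int_mod.span ?H}"
    by (intro subspace_mult_vimage int_mod.subspace_span)
  moreover have "F \<subseteq> {x. y * x \<in> int_mod.span ?H}" using left by (auto simp: mult.commute)
  ultimately have "x \<in> {x. y * x \<in> int_mod.span ?H}"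
    using int_mod.span_minimal assms(1) by blast
  thus ?thesis by (simp add: mult.commute)
qed

lemma powers_fg_mult:
  assumes "powers_fg x" "powers_fg y"
  shows "powers_fg (x * y)"
proof -
  from assms obtain F G where "finite F" "\<And>k. x ^ k \<in> int_mod.span F"
      and "finite G" "\<And>k. y ^ k \<in> int_mod.span G"
    unfolding powers_fg_def by metis
  thus ?thesis unfolding powers_fg_def
    by (intro exI[of _ "(\<lambda>(f, g). f * g) ` (F \<times> G)"])
       (auto simp: power_mult_distrib intro: int_span_mult)
qed

lemma powers_fg_prod_list: "(\<And>x. x \<in> set xs \<Longrightarrow> powers_fg x) \<Longrightarrow> powers_fg (prod_list xs)"
  by (induction xs) (auto simp: powers_fg_1 powers_fg_mult)

text \<open>With \<open>y\<close> the leading coefficient times \<open>x\<close>, the equation for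
  \<open>x\<close> becomes a monic integral one for \<open>y\<close>, so finitely many powers of
  \<open>y\<close> generate all of them.\<close>

lemma powers_fg_lead_coeff_mult:
  fixes p :: "int poly"
  assumes root: "poly (map_poly of_int p) x = 0" and p: "p \<noteq> 0"
  shows "powers_fg (of_int (lead_coeff p) * x)"
proof -
  define d where "d = degree p"
  define y where "y = of_int (lead_coeff p) * x"
  let ?F = "(\<lambda>i. y ^ i) ` {..<d}"
  have "d > 0"
  proof (rule ccontr)
    assume "\<not> d > 0"
    then obtain c where "p = [:c:]" unfolding d_def by (metis degree_eq_zeroE neq0_conv)
    thus False using root p by (simp add: map_poly_pCons)
  qed
  \<comment> \<open>The exponent \<open>d - 1\<close> turns the leading term into
    \<open>y ^ d\<close> and leaves integer coefficients at the lower powers of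
    \<open>y\<close>.\<close>
  have "0 = of_int (lead_coeff p) ^ (d - 1) * poly (map_poly of_int p) x"
    using root by simp
  also have "\<dots> = (\<Sum>i\<le>d. of_int (lead_coeff p) ^ (d - 1) * (of_int (coeff p i) * x ^ i))"
    by (simp add: poly_altdef degree_map_poly coeff_map_poly d_def sum_distrib_left)
  also have "{..d} = insert d {..<d}" by auto
  also have "(\<Sum>i\<in>insert d {..<d}. of_int (lead_coeff p) ^ (d - 1) * (of_int (coeff p i) * x ^ i))
      = of_int (lead_coeff p) ^ (d - 1) * (of_int (lead_coeff p) * x ^ d)
        + (\<Sum>i<d. of_int (lead_coeff p) ^ (d - 1) * (of_int (coeff p i) * x ^ i))"
    by (simp add: d_def)
  also have "of_int (lead_coeff p) ^ (d - 1) * (of_int (lead_coeff p) * x ^ d) = y ^ d"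
    using \<open>d > 0\<close> by (cases d) (auto simp: y_def power_mult_distrib)
  also have "(\<Sum>i<d. of_int (lead_coeff p) ^ (d - 1) * (of_int (coeff p i) * x ^ i))
      = (\<Sum>i<d. of_int (lead_coeff p ^ (d - 1 - i) * coeff p i) * y ^ i)"
  proof (rule sum.cong[OF refl])
    fix i assume "i \<in> {..<d}"
    hence "d - 1 = (d - 1 - i) + i" by auto
    hence "(of_int (lead_coeff p) :: complex) ^ (d - 1)
        = of_int (lead_coeff p) ^ (d - 1 - i) * of_int (lead_coeff p) ^ i"
      by (metis power_add)
    thus "of_int (lead_coeff p) ^ (d - 1) * (of_int (coeff p i) * x ^ i)
        = of_int (lead_coeff p ^ (d - 1 - i) * coeff p i) * y ^ i"
      by (simp add: y_def power_mult_distrib)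
  qed
  finally have "y ^ d = - (\<Sum>i<d. of_int (lead_coeff p ^ (d - 1 - i) * coeff p i) * y ^ i)"
    by (simp add: eq_neg_iff_add_eq_0)
  also have "\<dots> \<in> int_mod.span ?F"
    by (intro int_mod.span_neg int_mod.span_sum int_mod.span_scale int_mod.span_base) auto
  finally have yd: "y ^ d \<in> int_mod.span ?F" .
  \<comment> \<open>Multiplication by \<open>y\<close> shifts the generators; only the top one calls
    for \<open>yd\<close>.\<close>
  have step: "y * z \<in> int_mod.span ?F" if "z \<in> int_mod.span ?F" for z
  proof -
    have "int_mod.subspace {z. y * z \<in> int_mod.span ?F}"
      by (intro subspace_mult_vimage int_mod.subspace_span)
    moreover have "?F \<subseteq> {z. y * z \<in> int_mod.span ?F}"
    proof clarify
      fix i assume "i < d"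
      hence "Suc i < d \<or> Suc i = d" by auto
      hence "y ^ Suc i \<in> int_mod.span ?F"
      proof
        assume "Suc i < d"
        hence "y ^ Suc i \<in> ?F" by blast
        thus ?thesis by (rule int_mod.span_base)
      qed (use yd in metis)
      thus "y * y ^ i \<in> int_mod.span ?F" by simp
    qed
    ultimately show ?thesis using int_mod.span_minimal that by blast
  qed
  have "y ^ k \<in> int_mod.span ?F" for k
  proof (induction k)
    case 0
    have "y ^ 0 \<in> ?F" using \<open>d > 0\<close> by blast
    thus ?case by (rule int_mod.span_base)
  qed (use step in simp)
  thus ?thesis unfolding powers_fg_def y_def[symmetric] by blast
qed

section \<open>Rational numbers with finitely generated powers\<close>

lemma common_denominator:
  assumes "finite (A :: rat set)"
  obtains D :: int where "D > 0" "\<And>q. q \<in> A \<Longrightarrow> of_int D * q \<in> \<int>"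
proof -
  have "\<exists>D::int. D > 0 \<and> (\<forall>q\<in>A. of_int D * q \<in> \<int>)"
    using assms
  proof induction
    case empty
    show ?case by (intro exI[of _ 1]) auto
  next
    case (insert q A)
    then obtain D :: int where D: "D > 0" "\<forall>q\<in>A. of_int D * q \<in> \<int>" by blast
    obtain a b where ab: "quotient_of q = (a, b)" by (cases "quotient_of q")
    hence "b > 0" "q = of_int a / of_int b"
      using quotient_of_denom_pos quotient_of_div by blast+
    hence "of_int (D * b) * q = of_int (D * a)" by simp
    hence "of_int (D * b) * q \<in> \<int>" by (metis Ints_of_int)
    moreover have "of_int (D * b) * r \<in> \<int>" if "r \<in> A" for r
    proof -
      have "of_int (D * b) * r = of_int b * (of_int D * r)" by simp
      thus ?thesis using D that by (metis Ints_mult Ints_of_int)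
    qed
    ultimately show ?case using D \<open>b > 0\<close> by (intro exI[of _ "D * b"]) auto
  qed
  thus ?thesis using that by blast
qed

text \<open>Otherwise the exponent \<open>nat D\<close> gives a divisor of \<open>D\<close> of size
  at least \<open>2 ^ nat D\<close>, which exceeds \<open>D\<close>.\<close>

lemma int_dvd_powers_imp_unit:
  fixes v D :: int
  assumes "D > 0" "\<And>k. v ^ k dvd D"
  shows "\<bar>v\<bar> \<le> 1"
proof (rule ccontr)
  assume "\<not> \<bar>v\<bar> \<le> 1"
  hence "2 \<le> \<bar>v\<bar>" by linarith
  hence "2 ^ nat D \<le> \<bar>v\<bar> ^ nat D" by (intro power_mono) auto
  also have "\<dots> \<le> D" using zdvd_imp_le[of "\<bar>v\<bar> ^ nat D" D] assms(1) assms(2)[of "nat D"]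
    by (simp add: power_abs[symmetric])
  also have "D < 2 ^ nat D"
  proof -
    have "nat D < 2 ^ nat D" by (rule less_exp)
    hence "int (nat D) < int (2 ^ nat D)" by (simp only: of_nat_less_iff)
    thus ?thesis using assms(1) by simp
  qed
  finally show False by simp
qed

text \<open>
  A rational-linear functional sending 1 to 1 maps the finitely generated group containing all
  powers of the rational number into a group of bounded denominator.
\<close>

lemma powers_fg_of_rat_imp_int:
  fixes q :: rat
  assumes "powers_fg (of_rat q)"
  shows "q \<in> \<int>"
proof -
  interpret C: vector_space "\<lambda>(r::rat) (z::complex). of_rat r * z"
    by unfold_locales (simp_all add: algebra_simps of_rat_add of_rat_mult)
  interpret Q: vector_space "(*) :: rat \<Rightarrow> rat \<Rightarrow> rat"
    by unfold_locales (simp_all add: algebra_simps)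
  interpret CQ: vector_space_pair "\<lambda>(r::rat) (z::complex). of_rat r * z" "(*) :: rat \<Rightarrow> rat \<Rightarrow> rat"
    by unfold_locales
  have "C.independent {1}" by simp
  from CQ.linear_independent_extend[OF this, of "\<lambda>_. 1"]
  obtain \<phi> where lin: "Vector_Spaces.linear (\<lambda>(r::rat) (z::complex). of_rat r * z) (*) \<phi>"
    and "\<phi> 1 = 1" by auto
  interpret \<phi>: Vector_Spaces.linear "\<lambda>(r::rat) (z::complex). of_rat r * z" "(*)" \<phi> by fact
  have \<phi>_rat: "\<phi> (of_rat r) = r" for r
    using \<phi>.scale[of r 1] \<open>\<phi> 1 = 1\<close> by simp
  from assms obtain F where F: "finite F" "\<And>k. of_rat q ^ k \<in> int_mod.span F"
    unfolding powers_fg_def by blast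
  obtain D where D: "D > 0" "\<And>r. r \<in> \<phi> ` F \<Longrightarrow> of_int D * r \<in> \<int>"
    using common_denominator[of "\<phi> ` F"] F(1) by blast
  \<comment> \<open>This submodule contains the generators, so \<open>D\<close> clears the
    denominators of \<open>\<phi>\<close> on the whole span.\<close>
  have "int_mod.subspace {z. of_int D * \<phi> z \<in> \<int>}"
  proof (rule int_mod.subspaceI)
    fix c z assume "z \<in> {z. of_int D * \<phi> z \<in> \<int>}"
    moreover have "of_int D * \<phi> (of_int c * z) = of_int c * (of_int D * \<phi> z)"
      using \<phi>.scale[of "of_int c" z] by simp
    ultimately show "of_int c * z \<in> {z. of_int D * \<phi> z \<in> \<int>}"
      by (metis Ints_mult Ints_of_int mem_Collect_eq)
  qed (auto simp: \<phi>.zero \<phi>.add algebra_simps)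
  moreover have "F \<subseteq> {z. of_int D * \<phi> z \<in> \<int>}" using D(2) by auto
  ultimately have span: "int_mod.span F \<subseteq> {z. of_int D * \<phi> z \<in> \<int>}"
    by (rule int_mod.span_minimal[rotated])
  have pow: "of_int D * q ^ k \<in> \<int>" for k
  proof -
    have "of_int D * \<phi> (of_rat (q ^ k)) \<in> \<int>"
      using span F(2)[of k] by (auto simp: of_rat_power)
    thus ?thesis by (simp only: \<phi>_rat)
  qed
  obtain u v where uv: "quotient_of q = (u, v)" by (cases "quotient_of q")
  have v: "v > 0" "q = of_int u / of_int v" "coprime u v"
    using quotient_of_denom_pos quotient_of_div quotient_of_coprime uv by blast+
  have "v ^ k dvd D" for k
  proof -
    obtain n where "of_int D * q ^ k = of_int n" using pow[of k] by (elim Ints_cases)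
    hence "(of_int (D * u ^ k) :: rat) = of_int (n * v ^ k)"
      using v(1,2) by (simp add: field_simps)
    hence "D * u ^ k = n * v ^ k" by (simp only: of_int_eq_iff)
    hence "v ^ k dvd D * u ^ k" by simp
    moreover have "coprime (v ^ k) (u ^ k)" using v(3) by (simp add: coprime_commute)
    ultimately show ?thesis by (simp add: coprime_dvd_mult_left_iff)
  qed
  hence "\<bar>v\<bar> \<le> 1" using int_dvd_powers_imp_unit[OF D(1)] by blast
  hence "v = 1" using v(1) by linarith
  thus ?thesis using v(2) by simp
qed

lemma denominator_dvd_lead_coeffs:
  fixes p :: "complex \<Rightarrow> int poly" and r s :: int
  assumes p: "\<And>x. x \<in> set xs \<Longrightarrow> p x \<noteq> 0 \<and> poly (map_poly of_int (p x)) x = 0"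
    and prod: "prod_list xs = of_int r / of_int s" and s: "s \<noteq> 0" and "coprime r s"
  shows "s dvd (\<Prod>x\<leftarrow>xs. lead_coeff (p x))"
proof -
  define L where "L = (\<Prod>x\<leftarrow>xs. lead_coeff (p x))"
  have "powers_fg (\<Prod>x\<leftarrow>xs. of_int (lead_coeff (p x)) * x)"
    using p by (intro powers_fg_prod_list) (auto intro: powers_fg_lead_coeff_mult)
  also have "(\<Prod>x\<leftarrow>xs. of_int (lead_coeff (p x)) * x) = of_int L * prod_list xs"
    unfolding L_def by (induction xs) (simp_all add: algebra_simps)
  also have "\<dots> = of_rat (of_int (L * r) / of_int s)"
    by (simp add: prod of_rat_divide of_rat_mult)
  finally have "(of_int (L * r) / of_int s :: rat) \<in> \<int>" by (rule powers_fg_of_rat_imp_int)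
  then obtain n where "(of_int (L * r) / of_int s :: rat) = of_int n" by (elim Ints_cases)
  hence "(of_int (L * r) :: rat) = of_int (n * s)" using s by (simp add: field_simps)
  hence "L * r = n * s" by (simp only: of_int_eq_iff)
  hence "s dvd L * r" by simp
  thus ?thesis using \<open>coprime r s\<close>
    by (simp add: L_def coprime_dvd_mult_left_iff coprime_commute)
qed

text \<open>Pass to inverses: the reflected polynomial annihilates \<open>inverse x\<close>, and its
  leading coefficient is the old constant one.\<close>

lemma numerator_dvd_const_coeffs:
  fixes p :: "complex \<Rightarrow> int poly" and r s :: int
  assumes p: "\<And>x. x \<in> set xs \<Longrightarrow> coeff (p x) 0 \<noteq> 0 \<and> poly (map_poly of_int (p x)) x = 0"
    and prod: "prod_list xs = of_int r / of_int s" and "r \<noteq> 0" "s \<noteq> 0" and "coprime r s"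
  shows "r dvd (\<Prod>x\<leftarrow>xs. coeff (p x) 0)"
proof -
  have nz: "x \<noteq> 0" if "x \<in> set xs" for x
    using p[OF that] by (auto simp: poly_0_coeff_0 coeff_map_poly)
  have inv: "prod_list (map inverse xs) = inverse (prod_list xs)"
    by (induction xs) (simp_all add: nonzero_inverse_mult_distrib)
  have "r dvd (\<Prod>y\<leftarrow>map inverse xs. lead_coeff (reflect_poly (p (inverse y))))"
  proof (rule denominator_dvd_lead_coeffs)
    fix y assume "y \<in> set (map inverse xs)"
    then obtain x where x: "x \<in> set xs" "y = inverse x" by auto
    have "map_poly of_int (reflect_poly (p x)) = reflect_poly (map_poly of_int (p x) :: complex poly)"
      by (rule poly_eqI) (simp add: coeff_reflect_poly coeff_map_poly degree_map_poly)
    thus "reflect_poly (p (inverse y)) \<noteq> 0 \<and>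
        poly (map_poly of_int (reflect_poly (p (inverse y)))) y = 0"
      using p[OF x(1)] nz[OF x(1)] x(2) by (auto simp: poly_reflect_poly_nz)
  next
    show "prod_list (map inverse xs) = of_int s / of_int r"
      unfolding inv prod by simp
  qed (use assms in \<open>auto simp: coprime_commute\<close>)
  also have "(\<Prod>y\<leftarrow>map inverse xs. lead_coeff (reflect_poly (p (inverse y))))
      = (\<Prod>x\<leftarrow>xs. coeff (p x) 0)"
    using p by (auto simp: o_def coeff_reflect_poly intro!: arg_cong[of _ _ prod_list])
  finally show ?thesis .
qed

subsection \<open>Mahler measures and rational factorizations\<close>

lemma is_int_min_poly_int_min_poly: "algebraic x \<Longrightarrow> is_int_min_poly x (int_min_poly x)"
  unfolding int_min_poly_def by (rule theI') (rule int_min_poly_ex1)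

text \<open>Otherwise \<open>[:0, 1:]\<close> divides \<open>p\<close>, and irreducibility leaves
  only a unit multiple of it, whose sole root is 0.\<close>

lemma coeff_0_int_min_poly_nonzero:
  assumes "is_int_min_poly x p" "x \<noteq> 0"
  shows "coeff p 0 \<noteq> 0"
proof
  assume c0: "coeff p 0 = 0"
  obtain a q where "p = pCons a q" by (cases p)
  hence p: "p = [:0, 1:] * q" using c0 by simp
  have "\<not> is_unit [:0, 1 :: int:]" by (auto simp: is_unit_poly_iff)
  hence "is_unit q"
    using assms(1) p irreducibleD[of p "[:0, 1:]" q] by (auto simp: is_int_min_poly_def)
  then obtain c where "q = [:c:]" "is_unit c" by (auto simp: is_unit_poly_iff)
  thus False using assms p by (auto simp: is_int_min_poly_def map_poly_pCons)
qed

text \<open>The first bound drops nonnegative terms. For the second, the constant coefficient is up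
  to sign the leading one times the product of the roots.\<close>

lemma log_mahler_ge:
  assumes "algebraic x"
  shows "ln \<bar>real_of_int (lead_coeff (int_min_poly x))\<bar> \<le> log_mahler x"
    and "x \<noteq> 0 \<Longrightarrow> ln \<bar>real_of_int (coeff (int_min_poly x) 0)\<bar> \<le> log_mahler x"
proof -
  define p where "p = int_min_poly x"
  define P where "P = (map_poly of_int p :: complex poly)"
  have p: "is_int_min_poly x p" unfolding p_def by (rule is_int_min_poly_int_min_poly[OF assms])
  hence lead: "lead_coeff p > 0" by (simp add: is_int_min_poly_def)
  have m: "log_mahler x = ln \<bar>real_of_int (lead_coeff p)\<bar> + (\<Sum>z\<in>#proots P. ln (max 1 (cmod z)))"
    unfolding log_mahler_def Let_def P_def p_def by simp
  have "0 \<le> (\<Sum>z\<in>#M. ln (max 1 (cmod z)))" for M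
    by (induction M) auto
  thus "ln \<bar>real_of_int (lead_coeff (int_min_poly x))\<bar> \<le> log_mahler x"
    using m by (simp add: p_def)
  assume "x \<noteq> 0"
  hence c0: "coeff p 0 \<noteq> 0" using coeff_0_int_min_poly_nonzero p by blast
  have "of_int (coeff p 0) = poly P 0"
    by (simp add: poly_0_coeff_0 P_def coeff_map_poly)
  also have "P = smult (lead_coeff P) (\<Prod>z\<in>#proots P. [:-z, 1:])"
    by (rule complex_poly_decompose_multiset[symmetric])
  also have "poly \<dots> 0 = of_int (lead_coeff p) * (\<Prod>z\<in>#proots P. -z)"
    by (simp add: poly_prod_mset P_def degree_map_poly coeff_map_poly image_mset.compositionality o_def)
  finally have "cmod (of_int (coeff p 0)) = cmod (of_int (lead_coeff p) * (\<Prod>z\<in>#proots P. -z))"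
    by simp
  also have "\<dots> = \<bar>real_of_int (lead_coeff p)\<bar> * (\<Prod>z\<in>#proots P. cmod z)"
  proof -
    have "cmod (\<Prod>z\<in>#M. -z) = (\<Prod>z\<in>#M. cmod z)" for M
      by (induction M) (simp_all add: norm_mult)
    thus ?thesis by (simp add: norm_mult)
  qed
  finally have c: "\<bar>real_of_int (coeff p 0)\<bar>
      = \<bar>real_of_int (lead_coeff p)\<bar> * (\<Prod>z\<in>#proots P. cmod z)"
    by simp
  hence pos: "0 < (\<Prod>z\<in>#proots P. cmod z)"
    using c0 lead by (metis abs_of_pos of_int_0_less_iff zero_less_abs_iff zero_less_mult_pos of_int_eq_0_iff)
  \<comment> \<open>The four facts are proved jointly because the induction step uses the signs of
    both products.\<close>
  have "0 \<le> (\<Prod>z\<in>#M. cmod z) \<and> (\<Prod>z\<in>#M. cmod z) \<le> (\<Prod>z\<in>#M. max 1 (cmod z))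
      \<and> 1 \<le> (\<Prod>z\<in>#M. max 1 (cmod z))
      \<and> ln (\<Prod>z\<in>#M. max 1 (cmod z)) = (\<Sum>z\<in>#M. ln (max 1 (cmod z)))" for M
  proof (induction M)
    case (add z M)
    have "ln (max 1 (cmod z) * (\<Prod>z\<in>#M. max 1 (cmod z)))
        = ln (max 1 (cmod z)) + ln (\<Prod>z\<in>#M. max 1 (cmod z))"
      using add by (intro ln_mult_pos) (auto intro: less_le_trans)
    moreover have "cmod z * (\<Prod>z\<in>#M. cmod z) \<le> max 1 (cmod z) * (\<Prod>z\<in>#M. max 1 (cmod z))"
      using add by (intro mult_mono) auto
    moreover have "1 * 1 \<le> max 1 (cmod z) * (\<Prod>z\<in>#M. max 1 (cmod z))"
      using add by (intro mult_mono) auto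
    ultimately show ?case using add by simp
  qed simp
  note M = this[of "proots P"]
  have "ln \<bar>real_of_int (coeff p 0)\<bar>
      = ln \<bar>real_of_int (lead_coeff p)\<bar> + ln (\<Prod>z\<in>#proots P. cmod z)"
    unfolding c using pos lead by (intro ln_mult_pos) auto
  also have "\<dots> \<le> log_mahler x"
    using M pos unfolding m by (metis add_left_mono ln_mono)
  finally show "ln \<bar>real_of_int (coeff (int_min_poly x) 0)\<bar> \<le> log_mahler x"
    by (simp add: p_def)
qed

lemma log_mahler_nonneg:
  assumes "algebraic x"
  shows "0 \<le> log_mahler x"
proof -
  have "lead_coeff (int_min_poly x) \<ge> 1"
    using is_int_min_poly_int_min_poly[OF assms] by (simp add: is_int_min_poly_def)
  hence "0 \<le> ln \<bar>real_of_int (lead_coeff (int_min_poly x))\<bar>" by simp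
  thus ?thesis using log_mahler_ge(1)[OF assms] by linarith
qed

text \<open>The minimal polynomial is linear with coefficients \<open>- u\<close> and
  \<open>v\<close>, and \<open>v * max 1 (u / v) = max u v\<close>.\<close>

lemma log_mahler_of_fraction:
  fixes u v :: nat
  assumes "u > 0" "v > 0" "coprime u v"
  shows "log_mahler (of_nat u / of_nat v) = ln (real (max u v))"
proof -
  define p where "p = [:- int u, int v:]"
  have "irreducible p"
  proof (rule irreducibleI)
    show "p \<noteq> 0" "\<not> is_unit p" using assms by (auto simp: p_def is_unit_poly_iff)
    fix a b assume ab: "p = a * b"
    have "degree p = 1" using assms by (simp add: p_def)
    moreover have "a \<noteq> 0" "b \<noteq> 0" using \<open>p \<noteq> 0\<close> ab by auto
    ultimately have "degree a = 0 \<or> degree b = 0" using ab by (auto simp: degree_mult_eq)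
    \<comment> \<open>A constant factor divides both coefficients, so coprimality makes it a
      unit.\<close>
    moreover have "is_unit c" if c: "p = c * d" "degree c = 0" for c d
    proof -
      obtain e where e: "c = [:e:]" using c(2) by (rule degree_eq_zeroE)
      hence "[:e:] dvd p" unfolding c(1) by (metis dvd_triv_left)
      hence "e dvd coeff p 0" "e dvd coeff p 1" by (simp_all only: const_poly_dvd_iff)
      hence "e dvd int u" "e dvd int v" by (simp_all add: p_def)
      hence "is_unit e" using assms(3) by (meson coprime_common_divisor coprime_int_iff)
      thus ?thesis using e by (simp add: is_unit_const_poly_iff)
    qed
    ultimately show "is_unit a \<or> is_unit b" using ab by (metis mult.commute)
  qed
  hence "is_int_min_poly (of_nat u / of_nat v) p"
    using assms by (simp add: is_int_min_poly_def p_def map_poly_pCons)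
  moreover have alg: "algebraic (of_nat u / of_nat v :: complex)"
    by (intro rat_imp_algebraic Rats_divide) auto
  ultimately have p: "int_min_poly (of_nat u / of_nat v) = p"
    using int_min_poly_ex1[OF alg] is_int_min_poly_int_min_poly[OF alg] by blast
  have "map_poly of_int p = (smult (of_nat v) [:- (of_nat u / of_nat v), 1:] :: complex poly)"
    using assms by (simp add: p_def map_poly_pCons)
  hence "proots (map_poly of_int p) = proots [:- (of_nat u / of_nat v :: complex), 1:]"
    using assms(2) by (simp only: proots_smult of_nat_eq_0_iff)
  hence "proots (map_poly of_int p) = {# of_nat u / of_nat v :: complex #}"
    by simp
  hence "log_mahler (of_nat u / of_nat v) = ln (real v) + ln (max 1 (real u / real v))"
    using assms unfolding log_mahler_def Let_def p by (simp add: p_def norm_divide)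
  also have "\<dots> = ln (real v * max 1 (real u / real v))"
    using assms by (subst ln_mult_pos) auto
  also have "real v * max 1 (real u / real v) = real (max u v)"
    using assms by (auto simp: max_def field_simps)
  finally show ?thesis .
qed

text \<open>Iterated \<open>division_decomp\<close>; it serves to distribute numerator and
  denominator over the given factors.\<close>

lemma nat_dvd_prod_listE:
  fixes f :: "'a \<Rightarrow> nat"
  assumes "d dvd (\<Prod>x\<leftarrow>xs. f x)"
  obtains ds where "list_all2 (\<lambda>x d. d dvd f x) xs ds" "prod_list ds = d"
proof -
  have "\<exists>ds. list_all2 (\<lambda>x d. d dvd f x) xs ds \<and> prod_list ds = d"
    using assms
  proof (induction xs arbitrary: d)
    case (Cons x xs)
    hence "d dvd f x * (\<Prod>x\<leftarrow>xs. f x)" by simp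
    then obtain a b where "d = a * b" "a dvd f x" "b dvd (\<Prod>x\<leftarrow>xs. f x)"
      using division_decomp by blast
    moreover from Cons.IH[OF this(3)] obtain ds
      where "list_all2 (\<lambda>x d. d dvd f x) xs ds" "prod_list ds = b" by blast
    ultimately show ?case by (intro exI[of _ "a # ds"]) simp
  qed simp
  thus ?thesis using that by blast
qed

text \<open>
  The numerator divides the product of the constant coefficients of the minimal polynomials and the
  denominator the product of the leading ones, so both split along the given factorization.
\<close>

lemma rational_factorization:
  assumes xs: "xs \<in> alg_factorizations (of_nat r / of_nat s)"
    and rs: "r > 0" "s > 0" "coprime r s"
  obtains us vs where "length us = length xs" "length vs = length xs"
    "prod_list us = r" "prod_list vs = s"
    "\<And>i. i < length xs \<Longrightarrow> ln (real (max (us ! i) (vs ! i))) \<le> log_mahler (xs ! i)"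
proof -
  define c where "c x = nat \<bar>coeff (int_min_poly x) 0\<bar>" for x
  define a where "a x = nat \<bar>lead_coeff (int_min_poly x)\<bar>" for x
  have alg: "algebraic x" "x \<noteq> 0" "is_int_min_poly x (int_min_poly x)" if "x \<in> set xs" for x
    using xs that is_int_min_poly_int_min_poly by (auto simp: alg_factorizations_def)
  have c0: "coeff (int_min_poly x) 0 \<noteq> 0" if "x \<in> set xs" for x
    using alg[OF that] coeff_0_int_min_poly_nonzero by blast
  have prod: "prod_list xs = of_int (int r) / of_int (int s)"
    using xs by (simp add: alg_factorizations_def)
  have nat_prod: "nat \<bar>\<Prod>x\<leftarrow>ys. f x\<bar> = (\<Prod>x\<leftarrow>ys. nat \<bar>f x\<bar>)" for f :: "complex \<Rightarrow> int" and ys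
    by (induction ys) (simp_all add: nat_abs_mult_distrib)
  have "int r dvd (\<Prod>x\<leftarrow>xs. coeff (int_min_poly x) 0)"
    by (rule numerator_dvd_const_coeffs[OF _ prod])
       (use c0 alg(3) rs in \<open>auto simp: is_int_min_poly_def\<close>)
  hence "r dvd (\<Prod>x\<leftarrow>xs. c x)" by (simp only: c_def dvd_nat_abs_iff flip: nat_prod)
  then obtain us where us: "list_all2 (\<lambda>x u. u dvd c x) xs us" "prod_list us = r"
    by (rule nat_dvd_prod_listE)
  have "int s dvd (\<Prod>x\<leftarrow>xs. lead_coeff (int_min_poly x))"
    by (rule denominator_dvd_lead_coeffs[OF _ prod])
       (use c0 alg(3) rs in \<open>force simp: is_int_min_poly_def\<close>)+
  hence "s dvd (\<Prod>x\<leftarrow>xs. a x)" by (simp only: a_def dvd_nat_abs_iff flip: nat_prod)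
  then obtain vs where vs: "list_all2 (\<lambda>x v. v dvd a x) xs vs" "prod_list vs = s"
    by (rule nat_dvd_prod_listE)
  show ?thesis
  proof (rule that)
    show "length us = length xs" "length vs = length xs"
      using us(1) vs(1) by (auto dest: list_all2_lengthD)
    fix i assume i: "i < length xs"
    define x where "x = xs ! i"
    have x: "x \<in> set xs" using i by (simp add: x_def)
    have "us ! i dvd c x" "vs ! i dvd a x"
      using i us(1) vs(1) by (auto simp: x_def list_all2_conv_all_nth)
    moreover have "c x > 0" "a x > 0"
      using c0[OF x] alg(3)[OF x] by (auto simp: c_def a_def is_int_min_poly_def)
    ultimately have "us ! i \<le> c x" "vs ! i \<le> a x" "us ! i > 0" "vs ! i > 0"
      by (auto intro: dvd_imp_le dvd_pos_nat)
    hence "ln (real (us ! i)) \<le> ln (real (c x))" "ln (real (vs ! i)) \<le> ln (real (a x))"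
      by simp_all
    moreover have "ln (real (c x)) \<le> log_mahler x" "ln (real (a x)) \<le> log_mahler x"
      using log_mahler_ge[OF alg(1)[OF x]] alg(2)[OF x] by (simp_all add: c_def a_def)
    ultimately show "ln (real (max (us ! i) (vs ! i))) \<le> log_mahler (xs ! i)"
      by (auto simp: x_def max_def)
  qed (fact us(2) vs(2))+
qed

subsection \<open>Existence of exceptional points between two parameters\<close>

text \<open>Both sides extend to entire functions of the exponent, so the identity theorem carries
  equality from \<open>U\<close> to every real \<open>s\<close>.\<close>

lemma powr_sum_eqI:
  fixes ms ns :: "real list"
  assumes nonneg: "\<And>m. m \<in> set ms \<union> set ns \<Longrightarrow> 0 \<le> m"
    and U: "open U" "u \<in> U"
    and eq: "\<And>s. s \<in> U \<Longrightarrow> (\<Sum>m\<leftarrow>ms. m powr s) = (\<Sum>n\<leftarrow>ns. n powr s)"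
  shows "(\<Sum>m\<leftarrow>ms. m powr s) = (\<Sum>n\<leftarrow>ns. n powr s)"
proof -
  \<comment> \<open>Zero entries contribute 0 because \<open>0 powr s = 0\<close> for every
    \<open>s\<close>; the others give \<open>exp (s * ln m)\<close>.\<close>
  define f where "f ls z = (\<Sum>m\<leftarrow>ls. if m = 0 then 0 else exp (z * complex_of_real (ln m)))" for ls z
  have hol: "f ls holomorphic_on UNIV" for ls
  proof (induction ls)
    case (Cons m ls)
    have "f (m # ls) = (\<lambda>z. (if m = 0 then 0 else exp (z * complex_of_real (ln m))) + f ls z)"
      by (simp add: f_def fun_eq_iff)
    thus ?case using Cons by (cases "m = 0") (auto intro!: holomorphic_intros)
  qed (simp add: f_def)
  have f_real: "f ls (of_real r) = of_real (\<Sum>m\<leftarrow>ls. m powr r)" if "set ls \<subseteq> {0..}" for ls r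
    using that by (induction ls) (auto simp: f_def powr_def simp flip: exp_of_real)
  have sub: "set ms \<subseteq> {0..}" "set ns \<subseteq> {0..}" using nonneg by auto
  obtain e where e: "e > 0" "ball u e \<subseteq> U" using U openE by blast
  have "complex_of_real u islimpt of_real ` U"
    unfolding islimpt_approachable
  proof (intro allI impI)
    fix r :: real assume "r > 0"
    define w where "w = u + min e r / 2"
    have "w \<in> U" using e \<open>r > 0\<close> by (intro subsetD[OF e(2)]) (auto simp: w_def dist_real_def)
    moreover have "w \<noteq> u" "dist w u < r"
      using e \<open>r > 0\<close> by (auto simp: w_def dist_real_def)
    ultimately show "\<exists>x'\<in>complex_of_real ` U. x' \<noteq> of_real u \<and> dist x' (of_real u) < r"
      by (intro bexI[of _ "of_real w"]) (auto simp only: dist_of_real of_real_eq_iff)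
  qed
  hence "f ms (of_real s) - f ns (of_real s) = 0"
    by (rule analytic_continuation[where f = "\<lambda>z. f ms z - f ns z" and S = UNIV, rotated 5])
       (use hol eq sub in \<open>auto simp: f_real intro!: holomorphic_intros\<close>)
  thus ?thesis using sub by (simp add: f_real flip: of_real_diff)
qed

lemma tuple_mahler_nonneg: "0 \<le> tuple_mahler t xs"
  by (simp add: tuple_mahler_def)

lemma metric_mahler_le: "xs \<in> alg_factorizations \<alpha> \<Longrightarrow> metric_mahler t \<alpha> \<le> tuple_mahler t xs"
  unfolding metric_mahler_def
  by (rule cINF_lower) (auto intro: bdd_belowI[of _ 0] tuple_mahler_nonneg)

text \<open>
  Without exceptional points an optimal tuple is locally constant in \<open>t\<close> up to its function
  \<open>s \<mapsto> tuple_mahler s xs\<close>, because two such functions agreeing on an open set are equal; by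
  connectedness a single tuple would then be optimal at both ends.
\<close>

lemma exceptional_point_between:
  assumes "0 < c" "c \<le> d"
    and not_both: "\<And>xs. xs \<in> alg_factorizations \<alpha> \<Longrightarrow> tuple_mahler c xs = metric_mahler c \<alpha>
      \<Longrightarrow> tuple_mahler d xs = metric_mahler d \<alpha> \<Longrightarrow> False"
  shows "\<exists>t\<in>{c..d}. exceptional_point \<alpha> t"
proof (rule ccontr)
  assume "\<not> (\<exists>t\<in>{c..d}. exceptional_point \<alpha> t)"
  hence "\<not> exceptional_point \<alpha> t \<and> 0 < t" if "t \<in> {c..d}" for t
    using that \<open>0 < c\<close> by auto
  hence "\<exists>U xs. t \<in> {c..d} \<longrightarrow> open U \<and> t \<in> U \<and> U \<subseteq> {0<..} \<and> xs \<in> alg_factorizations \<alpha> \<and>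
      (\<forall>s\<in>U. tuple_mahler s xs \<le> metric_mahler s \<alpha>)" for t
    unfolding exceptional_point_def by (meson not_less)
  then obtain U X where UX: "\<And>t. t \<in> {c..d} \<Longrightarrow> open (U t) \<and> t \<in> U t \<and> U t \<subseteq> {0<..}
      \<and> X t \<in> alg_factorizations \<alpha> \<and> (\<forall>s\<in>U t. tuple_mahler s (X t) \<le> metric_mahler s \<alpha>)"
    by metis
  have opt: "tuple_mahler s (X t) = metric_mahler s \<alpha>" if "t \<in> {c..d}" "s \<in> U t" for s t
    using UX[OF that(1)] that(2) metric_mahler_le by (metis antisym)
  define f where "f t = (\<lambda>s. if s > 0 then tuple_mahler s (X t) else 0)" for t
  have f_eq: "f t = f u" if t: "t \<in> {c..d}" and u: "u \<in> {c..d}" "u \<in> U t" for t u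
  proof -
    \<comment> \<open>Both tuples are optimal on \<open>U t \<inter> U u\<close>, an open set
      containing \<open>u\<close>, so their power sums agree there and hence everywhere.\<close>
    have sums: "(\<Sum>m\<leftarrow>map log_mahler (X t). m powr s) = (\<Sum>m\<leftarrow>map log_mahler (X u). m powr s)" for s
    proof (rule powr_sum_eqI)
      show "open (U t \<inter> U u)" "u \<in> U t \<inter> U u" using UX t u by auto
      show "0 \<le> m" if "m \<in> set (map log_mahler (X t)) \<union> set (map log_mahler (X u))" for m
        using that UX t u(1) by (auto simp: alg_factorizations_def intro: log_mahler_nonneg)
      fix s assume s: "s \<in> U t \<inter> U u"
      hence "s > 0" using UX[OF t] by auto
      have "tuple_mahler s (X t) powr s = tuple_mahler s (X u) powr s"
        using opt s t u(1) by auto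
      moreover have "tuple_mahler s xs powr s = (\<Sum>m\<leftarrow>map log_mahler xs. m powr s)" for xs
      proof -
        have "0 \<le> (\<Sum>x\<leftarrow>xs. log_mahler x powr s)" by (induction xs) auto
        thus ?thesis using \<open>s > 0\<close> by (simp add: tuple_mahler_def powr_powr o_def)
      qed
      ultimately show "(\<Sum>m\<leftarrow>map log_mahler (X t). m powr s) = (\<Sum>m\<leftarrow>map log_mahler (X u). m powr s)"
        by simp
    qed
    thus ?thesis by (simp add: f_def fun_eq_iff tuple_mahler_def o_def)
  qed
  have "f c = f d"
  proof (rule connected_local_const)
    show "\<forall>t\<in>{c..d}. eventually (\<lambda>u. f t = f u) (at t within {c..d})"
      using UX f_eq unfolding eventually_at_topological by metis
  qed (use \<open>c \<le> d\<close> in auto)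
  \<comment> \<open>So \<open>X c\<close> is optimal at \<open>d\<close> as well as at
    \<open>c\<close>, against \<open>not_both\<close>.\<close>
  hence "tuple_mahler d (X c) = tuple_mahler d (X d)"
    using assms(1,2) by (simp add: f_def fun_eq_iff split: if_splits)
  thus False using not_both[of "X c"] opt[of c c] opt[of d d] UX[of c] UX[of d] \<open>c \<le> d\<close> by auto
qed

subsection \<open>Bounds for power sums\<close>

text \<open>
  For \<open>u \<noteq> v\<close> the height \<open>ln (max u v)\<close> exceeds the mean of \<open>ln u\<close> and \<open>ln v\<close> by a factor
  bounded away from 1 as long as \<open>u, v\<close> are bounded; large pairs are paid for by the power term.
\<close>

lemma fraction_height_bound:
  fixes t :: real
  assumes "1 < t"
  obtains \<delta> where "0 < \<delta>" "\<delta> \<le> 1"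
    "\<And>u v. 0 < u \<Longrightarrow> 0 < v \<Longrightarrow> u \<noteq> v \<or> u = 1 \<Longrightarrow>
       (1 + 2 * \<delta>) * ((ln (real u) + ln (real v)) / 2) \<le> ln (real (max u v)) + \<delta> / 2 * ln (real (max u v)) powr t"
proof -
  \<comment> \<open>Since \<open>K powr (t - 1) = 4\<close>, heights \<open>F \<ge> K\<close>
    satisfy \<open>\<delta> / 2 * F powr t \<ge> 2 * \<delta> * F\<close>, which pays for the whole
    excess.\<close>
  define K where "K = (4::real) powr (1 / (t - 1))"
  define M where "M = nat \<lceil>exp K\<rceil>"
  define S where "S = {(u, v). u \<in> {0<..<M} \<and> v \<in> {0<..<M} \<and> u \<noteq> v}"
  \<comment> \<open>For a given pair this is the largest \<open>\<delta>\<close> with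
    \<open>\<delta> * (2 * h + 1) \<le> F - h\<close>; the added 1 makes the denominator positive
    whenever \<open>0 \<le> h\<close>.\<close>
  define g where "g = (\<lambda>(u, v). let h = (ln (real u) + ln (real v)) / 2 in
    (ln (real (max u v)) - h) / (2 * h + 1))"
  have "finite S"
    by (rule finite_subset[of _ "{0<..<M} \<times> {0<..<M}"]) (auto simp: S_def)
  \<comment> \<open>Inserting 1 makes nonemptiness immediate and yields
    \<open>\<delta> \<le> 1\<close>.\<close>
  define \<delta> where "\<delta> = Min (insert 1 (g ` S))"
  have mean: "(ln (real u) + ln (real v)) / 2 < ln (real (max u v))"
    if "0 < u" "0 < v" "u \<noteq> v" for u v
    using that by (auto simp: max_def)
  have mean0: "0 \<le> (ln (real u) + ln (real v)) / 2" if "0 < u" "0 < v" for u v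
    using that by simp
  have "0 < g x" if "x \<in> S" for x
    using that mean mean0 by (auto simp: S_def g_def Let_def intro!: divide_pos_pos add_nonneg_pos)
  hence "0 < \<delta>" using \<open>finite S\<close> by (simp add: \<delta>_def)
  have "\<delta> \<le> 1" using \<open>finite S\<close> by (simp add: \<delta>_def)
  show ?thesis
  proof (rule that[OF \<open>0 < \<delta>\<close> \<open>\<delta> \<le> 1\<close>])
    fix u v :: nat assume uv: "0 < u" "0 < v" "u \<noteq> v \<or> u = 1"
    define h where "h = (ln (real u) + ln (real v)) / 2"
    define F where "F = ln (real (max u v))"
    have "0 \<le> h" using mean0 uv by (simp add: h_def)
    have "h \<le> F" using uv by (auto simp: h_def F_def max_def)
    have F_powr: "0 \<le> \<delta> / 2 * F powr t" using \<open>0 < \<delta>\<close> by simp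
    have "(1 + 2 * \<delta>) * h \<le> F + \<delta> / 2 * F powr t"
    proof (cases "M \<le> max u v")
      case True
      have "exp K \<le> real M" unfolding M_def by linarith
      also have "\<dots> \<le> real (max u v)" using True by linarith
      finally have "K \<le> F" using uv by (simp add: F_def ln_ge_iff)
      have "0 < K" by (simp add: K_def)
      have "4 = K powr (t - 1)" using assms by (simp add: K_def powr_powr)
      also have "\<dots> \<le> F powr (t - 1)"
        using \<open>K \<le> F\<close> \<open>0 < K\<close> assms by (intro powr_mono2) auto
      finally have "4 * F \<le> F powr (t - 1) * F powr 1"
        using \<open>K \<le> F\<close> \<open>0 < K\<close> by (simp add: mult_right_mono)
      also have "\<dots> = F powr t" by (simp only: powr_add[symmetric]) simp
      finally have "\<delta> / 2 * (4 * F) \<le> \<delta> / 2 * F powr t"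
        using \<open>0 < \<delta>\<close> by (intro mult_left_mono) auto
      moreover have "2 * \<delta> * h \<le> 2 * \<delta> * F"
        using \<open>h \<le> F\<close> \<open>0 < \<delta>\<close> by (intro mult_left_mono) auto
      ultimately show ?thesis using \<open>h \<le> F\<close> by (simp add: algebra_simps)
    next
      case False
      show ?thesis
      \<comment> \<open>Equality occurs only for \<open>u = v = 1\<close>, where all logarithms
        vanish.\<close>
      proof (cases "u = v")
        case True
        thus ?thesis using uv by (simp add: h_def F_def)
      next
        case False
        hence "(u, v) \<in> S" using uv \<open>\<not> M \<le> max u v\<close> by (auto simp: S_def)
        hence "\<delta> \<le> g (u, v)" using \<open>finite S\<close> by (auto simp: \<delta>_def intro!: Min_le)
        also have "g (u, v) = (F - h) / (2 * h + 1)"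
          by (simp only: g_def Let_def h_def F_def prod.case)
        finally have "\<delta> * (2 * h + 1) \<le> F - h"
          using \<open>0 \<le> h\<close> by (simp add: pos_le_divide_eq)
        hence "(1 + 2 * \<delta>) * h \<le> F" using \<open>0 < \<delta>\<close> by (simp add: algebra_simps)
        thus ?thesis using F_powr by linarith
      qed
    qed
    thus "(1 + 2 * \<delta>) * ((ln (real u) + ln (real v)) / 2) \<le> ln (real (max u v)) + \<delta> / 2 * ln (real (max u v)) powr t"
      by (simp add: h_def F_def)
  qed
qed

section \<open>Power sums over factorizations\<close>

abbreviation power_sum :: "real \<Rightarrow> complex list \<Rightarrow> real" where
  "power_sum t xs \<equiv> \<Sum>x\<leftarrow>xs. log_mahler x powr t"

lemma power_sum_nonneg: "0 \<le> power_sum t xs"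
  by (induction xs) auto

lemma power_sum_mono:
  assumes "0 < t" "tuple_mahler t xs \<le> tuple_mahler t ys"
  shows "power_sum t xs \<le> power_sum t ys"
proof -
  have "tuple_mahler t zs powr t = power_sum t zs" for zs
    using assms(1) power_sum_nonneg[of t zs] by (simp add: tuple_mahler_def powr_powr)
  thus ?thesis using assms tuple_mahler_nonneg by (metis less_imp_le powr_mono2)
qed

lemma ln_prod_list:
  fixes us :: "nat list"
  assumes "0 < prod_list us"
  shows "ln (real (prod_list us)) = (\<Sum>i<length us. ln (real (us ! i)))"
proof -
  have "ln (real (prod_list us)) = (\<Sum>u\<leftarrow>us. ln (real u))"
    using assms by (induction us) (simp_all add: ln_mult_pos)
  thus ?thesis by (simp add: sum_list_sum_nth atLeast0LessThan)
qed

text \<open>Summing \<open>piece\<close> over the pairs of the rational factorization gives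
  \<open>(1 + 2 * \<delta>) * T\<close> on the left; \<open>upper\<close> bounds the extra power
  term by \<open>\<delta> * T\<close>, which leaves half of the gain.\<close>

lemma power_sum_lower_bound:
  fixes r s :: nat and t q \<delta> :: real
  defines "T \<equiv> (ln (real r) + ln (real s)) / 2"
  assumes xs: "xs \<in> alg_factorizations (of_nat r / of_nat s)"
    and rs: "odd r" "odd s" "coprime r s"
    and \<delta>: "0 < \<delta>" and t: "0 < t" and q: "1 \<le> q"
    and piece: "\<And>u v. 0 < u \<Longrightarrow> 0 < v \<Longrightarrow> u \<noteq> v \<or> u = 1 \<Longrightarrow>
       (1 + 2 * \<delta>) * ((ln (real u) + ln (real v)) / 2) \<le> ln (real (max u v)) + \<delta> / 2 * ln (real (max u v)) powr t"
    and upper: "power_sum t xs \<le> 2 * T"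
  shows "(1 + \<delta>) * T \<le> power_sum q xs"
proof -
  have "0 < r" "0 < s" using rs by (auto intro: odd_pos)
  obtain us vs where len: "length us = length xs" "length vs = length xs"
    and prod: "prod_list us = r" "prod_list vs = s"
    and le: "\<And>i. i < length xs \<Longrightarrow> ln (real (max (us ! i) (vs ! i))) \<le> log_mahler (xs ! i)"
    using rational_factorization[OF xs \<open>0 < r\<close> \<open>0 < s\<close> rs(3)] by metis
  let ?N = "length xs"
  define F where "F i = ln (real (max (us ! i) (vs ! i)))" for i
  have dvd: "us ! i dvd r" "vs ! i dvd s" if "i < ?N" for i
    using that len prod by (auto intro: prod_list_dvd)
  have pos: "0 < us ! i" "0 < vs ! i" if "i < ?N" for i
    using dvd[OF that] \<open>0 < r\<close> \<open>0 < s\<close> by (auto intro: dvd_pos_nat)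
  have F_nonneg: "0 \<le> F i" if "i < ?N" for i
    using pos[OF that] by (simp add: F_def)
  \<comment> \<open>Oddness makes every nonzero height at least \<open>ln 3\<close>, which exceeds
    1, so that \<open>F i \<le> F i powr q\<close>.\<close>
  have F_or: "F i = 0 \<or> 1 \<le> F i" if "i < ?N" for i
  proof (cases "max (us ! i) (vs ! i) = 1")
    case False
    have "odd (max (us ! i) (vs ! i))"
      using dvd[OF that] rs(1,2) by (auto simp: max_def dest: dvd_trans)
    with False have "3 \<le> max (us ! i) (vs ! i)" by presburger
    hence "exp 1 \<le> real (max (us ! i) (vs ! i))" using exp_le by linarith
    thus ?thesis using pos[OF that] by (simp add: F_def ln_ge_iff)
  qed (simp add: F_def)
  have sum: "power_sum p xs = (\<Sum>i<?N. log_mahler (xs ! i) powr p)" for p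
    by (simp add: sum_list_sum_nth atLeast0LessThan)
  have F_q: "F i \<le> log_mahler (xs ! i) powr q" if "i < ?N" for i
  proof -
    have "F i \<le> F i powr q"
      using F_or[OF that] q powr_mono[of 1 q "F i"] by auto
    also have "\<dots> \<le> log_mahler (xs ! i) powr q"
      using le[OF that] F_nonneg[OF that] q by (intro powr_mono2) (auto simp: F_def)
    finally show ?thesis .
  qed
  have F_t: "F i powr t \<le> log_mahler (xs ! i) powr t" if "i < ?N" for i
    using le[OF that] F_nonneg[OF that] t by (intro powr_mono2) (auto simp: F_def)
  have "T = (\<Sum>i<?N. (ln (real (us ! i)) + ln (real (vs ! i))) / 2)"
    using ln_prod_list[of us] ln_prod_list[of vs] \<open>0 < r\<close> \<open>0 < s\<close>
    by (simp add: T_def prod len sum.distrib flip: sum_divide_distrib)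
  hence "(1 + 2 * \<delta>) * T = (1 + 2 * \<delta>) * (\<Sum>i<?N. (ln (us ! i) + ln (vs ! i)) / 2)"
    by (rule arg_cong)
  also have "\<dots> = (\<Sum>i<?N. (1 + 2 * \<delta>) * ((ln (us ! i) + ln (vs ! i)) / 2))"
    by (rule sum_distrib_left)
  also have "\<dots> \<le> (\<Sum>i<?N. F i + \<delta> / 2 * F i powr t)"
  proof (rule sum_mono)
    fix i assume "i \<in> {..<?N}"
    hence i: "i < ?N" by simp
    \<comment> \<open>Divisors of the coprime numbers \<open>r\<close> and \<open>s\<close> coincide
      only when both are 1.\<close>
    have "us ! i \<noteq> vs ! i \<or> us ! i = 1"
      using dvd[OF i] rs(3) by (metis coprime_common_divisor_nat)
    from piece[OF pos[OF i] this]
    show "(1 + 2 * \<delta>) * ((ln (us ! i) + ln (vs ! i)) / 2) \<le> F i + \<delta> / 2 * F i powr t"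
      by (simp add: F_def)
  qed
  also have "\<dots> \<le> (\<Sum>i<?N. log_mahler (xs ! i) powr q + \<delta> / 2 * log_mahler (xs ! i) powr t)"
    using F_q F_t \<delta> by (intro sum_mono add_mono mult_left_mono) auto
  also have "\<dots> = power_sum q xs + \<delta> / 2 * power_sum t xs"
    by (simp only: sum sum.distrib sum_distrib_left)
  also have "\<dots> \<le> power_sum q xs + \<delta> / 2 * (2 * T)"
    using upper \<delta> by (intro add_left_mono mult_left_mono) auto
  finally show ?thesis by (simp add: algebra_simps)
qed

subsection \<open>A family with many exceptional points\<close>

text \<open>The largest \<open>a\<close> with \<open>3 ^ a \<le> 5 ^ n\<close>; it makes numerator
  and denominator of \<open>alpha n\<close> nearly equal on the logarithmic scale.\<close>

definition num_exp :: "nat \<Rightarrow> nat" where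
  "num_exp n = nat \<lfloor>real n * ln 5 / ln 3\<rfloor>"

lemma num_exp_bounds:
  "real (num_exp n) * ln 3 \<le> real n * ln 5" "real n * ln 5 < (real (num_exp n) + 1) * ln 3"
proof -
  define y where "y = real n * ln 5 / ln 3"
  have "0 \<le> y" by (simp add: y_def)
  hence "real (num_exp n) \<le> y" "y < real (num_exp n) + 1" unfolding num_exp_def y_def[symmetric] by linarith+
  thus "real (num_exp n) * ln 3 \<le> real n * ln 5" "real n * ln 5 < (real (num_exp n) + 1) * ln 3"
    by (simp_all add: y_def field_simps)
qed

text \<open>Rounding loses less than one per copy, so \<open>k\<close> copies of
  \<open>alpha m\<close> need at most \<open>k\<close> additional factors 3 to give
  \<open>alpha (k * m)\<close>.\<close>

lemma num_exp_mult_bounds: "k * num_exp m \<le> num_exp (k * m)" "num_exp (k * m) \<le> k * num_exp m + k"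
proof -
  have "real k * (real (num_exp m) * ln 3) \<le> real k * (real m * ln 5)"
    by (intro mult_left_mono num_exp_bounds) auto
  also have "\<dots> = real (k * m) * ln 5" by simp
  also have "\<dots> < (real (num_exp (k * m)) + 1) * ln 3" by (rule num_exp_bounds)
  finally have "(real k * real (num_exp m)) * ln 3 < (real (num_exp (k * m)) + 1) * ln 3"
    by (simp add: mult.assoc)
  hence "real k * real (num_exp m) < real (num_exp (k * m)) + 1" by (rule mult_right_less_imp_less) simp
  hence "real (k * num_exp m) < real (num_exp (k * m) + 1)" by simp
  thus "k * num_exp m \<le> num_exp (k * m)" by (simp only: of_nat_less_iff less_Suc_eq_le Suc_eq_plus1[symmetric])
  have "real (num_exp (k * m)) * ln 3 \<le> real (k * m) * ln 5" by (rule num_exp_bounds)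
  also have "\<dots> = real k * (real m * ln 5)" by simp
  also have "\<dots> \<le> real k * ((real (num_exp m) + 1) * ln 3)"
    by (intro mult_left_mono less_imp_le[OF num_exp_bounds(2)]) auto
  finally have "real (num_exp (k * m)) * ln 3 \<le> (real k * (real (num_exp m) + 1)) * ln 3" 
    by (simp add: mult.assoc)
  hence "real (num_exp (k * m)) \<le> real k * (real (num_exp m) + 1)" by (rule mult_right_le_imp_le) simp
  hence "real (num_exp (k * m)) \<le> real (k * num_exp m + k)" by (simp add: algebra_simps)
  thus "num_exp (k * m) \<le> k * num_exp m + k" by (simp only: of_nat_le_iff)
qed

definition alpha :: "nat \<Rightarrow> rat" where
  "alpha n = 3 ^ num_exp n / 5 ^ n"

text \<open>This is the \<open>T\<close> of \<open>power_sum_lower_bound\<close> for the fraction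
  \<open>alpha n\<close>.\<close>

definition mean_height :: "nat \<Rightarrow> real" where
  "mean_height n = (ln (real (3 ^ num_exp n)) + ln (real (5 ^ n))) / 2"

lemma of_rat_alpha: "of_rat (alpha n) = (of_nat (3 ^ num_exp n) / of_nat (5 ^ n) :: complex)"
  by (simp add: alpha_def of_rat_divide of_rat_power)

lemma coprime_powers_3_5: "coprime (3 ^ a) (5 ^ b :: nat)"
proof -
  have "coprime 3 (5 :: nat)" by (simp add: coprime_iff_gcd_eq_1 gcd_non_0_nat)
  thus ?thesis by simp
qed

text \<open>Rounding down in \<open>num_exp\<close> makes the denominator the larger part.\<close>

lemma log_mahler_alpha: "log_mahler (of_rat (alpha n)) = real n * ln 5"
proof -
  have "ln (real (3 ^ num_exp n)) \<le> ln (real (5 ^ n))"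
    using num_exp_bounds(1)[of n] by (simp add: ln_realpow)
  hence "real (3 ^ num_exp n) \<le> real (5 ^ n)" by (subst (asm) ln_le_cancel_iff) auto
  hence "(3::nat) ^ num_exp n \<le> 5 ^ n" by (simp only: of_nat_le_iff)
  hence "max (3 ^ num_exp n) (5 ^ n) = (5::nat) ^ n" by simp
  hence "ln (real (max (3 ^ num_exp n) (5 ^ n))) = real n * ln 5" by (simp add: ln_realpow)
  moreover have "log_mahler (of_nat (3 ^ num_exp n) / of_nat (5 ^ n)) = ln (real (max (3 ^ num_exp n) (5 ^ n)))"
    by (rule log_mahler_of_fraction) (use coprime_powers_3_5 in simp_all)
  ultimately show ?thesis by (simp only: of_rat_alpha)
qed

lemma log_mahler_3: "log_mahler 3 = ln 3"
  using log_mahler_of_fraction[of 3 1] by simp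

text \<open>Use \<open>k\<close> copies of \<open>alpha m\<close> and at most \<open>k\<close>
  factors 3. For large \<open>m\<close> the factors 3 cost little at exponent 1, and continuity
  extends the estimate to some \<open>t > 1\<close>; neither \<open>m\<close> nor \<open>t\<close>
  depends on \<open>k\<close>.\<close>

lemma efficient_factorization:
  fixes c \<delta> :: real
  assumes "0 < \<delta>" "\<delta> \<le> 1" "1 < c"
  obtains m t where "0 < m" "1 < t" "t < c"
    "\<And>k. 0 < k \<Longrightarrow> \<exists>ys\<in>alg_factorizations (of_rat (alpha (k * m))).
        power_sum t ys < (1 + \<delta>) * mean_height (k * m)"
proof -
  define x y :: real where "x = ln 3" and "y = ln 5"
  have xy: "0 < x" "x < y" by (simp_all add: x_def y_def)
  \<comment> \<open>This choice makes \<open>\<delta> * Y\<close> exceed \<open>2 * x\<close>, which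
    covers one factor 3 per copy and, as \<open>\<delta> \<le> 1\<close>, the rounding loss
    \<open>(1 + \<delta>) * (x / 2)\<close>.\<close>
  define m where "m = nat \<lceil>2 / \<delta>\<rceil>"
  have "2 / \<delta> \<le> real m" unfolding m_def by linarith
  hence "2 \<le> \<delta> * real m" using assms(1) by (simp add: field_simps)
  hence "0 < m" by (intro Nat.gr0I) auto
  define Y where "Y = real m * y"
  have "0 < Y" using \<open>0 < m\<close> xy by (simp add: Y_def)
  have "2 * y \<le> (\<delta> * real m) * y"
    using \<open>2 \<le> \<delta> * real m\<close> xy by (intro mult_right_mono) auto
  also have "\<dots> = \<delta> * Y" by (simp add: Y_def)
  finally have "2 * x < \<delta> * Y" using xy by linarith
  moreover have "(1 + \<delta>) * (x / 2) \<le> 2 * (x / 2)"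
    using assms xy by (intro mult_right_mono) auto
  moreover have "(1 + \<delta>) * (Y - x / 2) = Y + \<delta> * Y - (1 + \<delta>) * (x / 2)"
    by (simp add: algebra_simps)
  moreover have "Y powr 1 = Y" "x powr 1 = x" using \<open>0 < Y\<close> xy by simp_all
  ultimately have at_1: "Y powr 1 + x powr 1 < (1 + \<delta>) * (Y - x / 2)" by linarith
  \<comment> \<open>The strict inequality at 1 persists for exponents slightly above 1.\<close>
  have "((\<lambda>t. Y powr t + x powr t) \<longlongrightarrow> Y powr 1 + x powr 1) (at_right 1)"
    using xy \<open>0 < Y\<close> by (intro tendsto_intros) auto
  hence "eventually (\<lambda>t. Y powr t + x powr t < (1 + \<delta>) * (Y - x / 2)) (at_right 1)"
    using at_1 by (rule order_tendstoD(2))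
  moreover have "eventually (\<lambda>t::real. t \<in> {1<..<c}) (at_right 1)"
    using assms(3) by (rule eventually_at_right_real)
  ultimately have "eventually (\<lambda>t. Y powr t + x powr t < (1 + \<delta>) * (Y - x / 2)
      \<and> t \<in> {1<..<c}) (at_right 1)"
    by (rule eventually_conj)
  then obtain t where t: "Y powr t + x powr t < (1 + \<delta>) * (Y - x / 2)"
      "1 < t" "t < c"
    using eventually_happens[of _ "at_right (1::real)"] by auto
  show ?thesis
  proof (rule that[OF \<open>0 < m\<close> t(2,3)])
    fix k :: nat assume "0 < k"
    define e where "e = num_exp (k * m) - k * num_exp m"
    have e: "num_exp (k * m) = k * num_exp m + e" "e \<le> k" using num_exp_mult_bounds[of k m] by (auto simp: e_def)
    define ys where "ys = replicate k (of_rat (alpha m)) @ replicate e (3::complex)"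
    have "prod_list ys = of_rat (alpha (k * m))"
    proof -
      have "alpha (k * m) = alpha m ^ k * 3 ^ e"
        unfolding alpha_def e(1)
        by (simp add: power_add power_divide power_mult[symmetric] mult.commute)
      thus ?thesis by (simp add: ys_def of_rat_mult of_rat_power)
    qed
    moreover have "algebraic (of_rat (alpha m) :: complex)" "of_rat (alpha m) \<noteq> (0::complex)"
      by (auto intro: rat_imp_algebraic simp: alpha_def)
    ultimately have "ys \<in> alg_factorizations (of_rat (alpha (k * m)))"
      using \<open>0 < k\<close> by (auto simp: alg_factorizations_def ys_def)
    moreover have "power_sum t ys < (1 + \<delta>) * mean_height (k * m)"
    proof -
      have "power_sum t ys = real k * Y powr t + real e * x powr t"
        by (simp add: ys_def log_mahler_alpha log_mahler_3 sum_list_replicate x_def Y_def y_def)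
      also have "\<dots> \<le> real k * Y powr t + real k * x powr t"
        using e(2) by (intro add_left_mono mult_right_mono) auto
      also have "\<dots> = real k * (Y powr t + x powr t)" by (simp add: algebra_simps)
      also have "\<dots> < real k * ((1 + \<delta>) * (Y - x / 2))"
        using t(1) \<open>0 < k\<close> by (intro mult_strict_left_mono) auto
      also have "\<dots> = (1 + \<delta>) * (real (k * m) * y - real k * (x / 2))" by (simp add: Y_def algebra_simps)
      also have "\<dots> \<le> (1 + \<delta>) * mean_height (k * m)"
      proof (rule mult_left_mono)
        \<comment> \<open>Rounding costs the numerator at most \<open>x\<close> on the logarithmic
          scale, hence the mean at most \<open>x / 2\<close>.\<close>
        have "mean_height (k * m) = (real (num_exp (k * m)) * x + real (k * m) * y) / 2"
          by (simp add: mean_height_def ln_realpow x_def y_def)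
        moreover have "real (k * m) * y - x \<le> real (num_exp (k * m)) * x"
          using num_exp_bounds(2)[of "k * m"] by (simp add: x_def y_def algebra_simps)
        moreover have "x / 2 \<le> real k * (x / 2)"
          using \<open>0 < k\<close> xy by simp
        ultimately show "real (k * m) * y - real k * (x / 2) \<le> mean_height (k * m)" by argo
      qed (use assms in auto)
      finally show ?thesis .
    qed
    ultimately show "\<exists>ys\<in>alg_factorizations (of_rat (alpha (k * m))).
        power_sum t ys < (1 + \<delta>) * mean_height (k * m)" by blast
  qed
qed

text \<open>First \<open>e\<close> is chosen, then \<open>\<delta>\<close> from \<open>e\<close>,
  then \<open>d < e\<close> from \<open>\<delta>\<close>. A tuple optimal at \<open>e\<close> meets
  the hypotheses of \<open>power_sum_lower_bound\<close>, and the resulting bound excludes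
  optimality at \<open>d\<close>.\<close>

lemma exceptional_point_near_1:
  fixes c :: real
  assumes "1 < c"
  obtains m d e where "0 < m" "1 < d" "e < c"
    "\<And>k. 0 < k \<Longrightarrow> \<exists>t\<in>{d..e}. exceptional_point (of_rat (alpha (k * m))) t"
proof -
  \<comment> \<open>The value 1 for \<open>\<delta>\<close> supplies the upper bound
    \<open>2 * T\<close> that \<open>power_sum_lower_bound\<close> asks for.\<close>
  obtain m1 e where e: "0 < m1" "1 < e" "e < c"
    "\<And>k. 0 < k \<Longrightarrow> \<exists>ys\<in>alg_factorizations (of_rat (alpha (k * m1))).
        power_sum e ys < (1 + 1) * mean_height (k * m1)"
    using efficient_factorization[of 1 c] assms by (metis zero_less_one order_refl)
  obtain \<delta> where \<delta>: "0 < \<delta>" "\<delta> \<le> 1"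
    and piece: "\<And>u v. 0 < u \<Longrightarrow> 0 < v \<Longrightarrow> u \<noteq> v \<or> u = 1 \<Longrightarrow>
       (1 + 2 * \<delta>) * ((ln (real u) + ln (real v)) / 2) \<le> ln (real (max u v)) + \<delta> / 2 * ln (real (max u v)) powr e"
    using fraction_height_bound[OF e(2)] by metis
  obtain m2 d where d: "0 < m2" "1 < d" "d < e"
    "\<And>k. 0 < k \<Longrightarrow> \<exists>ys\<in>alg_factorizations (of_rat (alpha (k * m2))).
        power_sum d ys < (1 + \<delta>) * mean_height (k * m2)"
    using efficient_factorization[OF \<delta> e(2)] by metis
  show ?thesis
  \<comment> \<open>Multiples of \<open>m1 * m2\<close> admit both efficient factorizations.\<close>
  proof (rule that[of "m1 * m2" d e])
    fix k :: nat assume "0 < k"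
    define n where "n = k * (m1 * m2)"
    let ?\<alpha> = "of_rat (alpha n) :: complex"
    obtain ys1 where ys1: "ys1 \<in> alg_factorizations ?\<alpha>" "power_sum e ys1 < 2 * mean_height n"
      using e(4)[of "k * m2"] \<open>0 < k\<close> d(1) by (auto simp: n_def mult_ac)
    obtain ys2 where ys2: "ys2 \<in> alg_factorizations ?\<alpha>" "power_sum d ys2 < (1 + \<delta>) * mean_height n"
      using d(4)[of "k * m1"] \<open>0 < k\<close> e(1) by (auto simp: n_def mult_ac)
    show "\<exists>t\<in>{d..e}. exceptional_point (of_rat (alpha (k * (m1 * m2)))) t"
      unfolding n_def[symmetric]
    proof (rule exceptional_point_between)
      fix xs assume xs: "xs \<in> alg_factorizations ?\<alpha>"
        and opt: "tuple_mahler d xs = metric_mahler d ?\<alpha>" "tuple_mahler e xs = metric_mahler e ?\<alpha>"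
      have "power_sum e xs \<le> power_sum e ys1"
        using e(2) opt(2) metric_mahler_le[OF ys1(1)] by (intro power_sum_mono) auto
      hence "power_sum e xs \<le> 2 * ((ln (real (3 ^ num_exp n)) + ln (real (5 ^ n))) / 2)"
        using ys1(2) unfolding mean_height_def by linarith
      hence "(1 + \<delta>) * mean_height n \<le> power_sum d xs"
        unfolding mean_height_def
        using xs \<delta>(1) e(2) d(2) piece coprime_powers_3_5 unfolding of_rat_alpha
        by (intro power_sum_lower_bound[where t = e]) auto
      also have "\<dots> \<le> power_sum d ys2"
        using d(2) opt(1) metric_mahler_le[OF ys2(1)] by (intro power_sum_mono) auto
      finally show False using ys2(2) by simp
    qed (use d in auto)
  qed (use d e in auto)
qed

text \<open>Each new point is found above 1 but to the left of all earlier ones. Quantifying over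
  all \<open>k\<close> keeps the earlier points when \<open>m1\<close> is replaced by
  \<open>m1 * m2\<close>.\<close>

lemma many_exceptional_points:
  fixes c :: real
  assumes "1 < c"
  shows "\<exists>m>0. \<exists>d. 1 < d \<and> d < c \<and> (\<forall>k>0. \<exists>T\<subseteq>{d<..<c}. finite T \<and> card T = N \<and>
           (\<forall>t\<in>T. exceptional_point (of_rat (alpha (k * m))) t))"
proof (induction N)
  case 0
  show ?case using assms dense[of 1 c] by (intro exI[of _ 1]) (auto intro!: exI[of _ "{}"])
next
  case (Suc N)
  then obtain m1 d1 where m1: "0 < m1" "1 < d1" "d1 < c"
    and T: "\<And>k. 0 < k \<Longrightarrow> \<exists>T\<subseteq>{d1<..<c}. finite T \<and> card T = N \<and>
           (\<forall>t\<in>T. exceptional_point (of_rat (alpha (k * m1))) t)" by blast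
  obtain m2 d2 e where m2: "0 < m2" "1 < d2" "e < d1"
    and t: "\<And>k. 0 < k \<Longrightarrow> \<exists>t\<in>{d2..e}. exceptional_point (of_rat (alpha (k * m2))) t"
    using exceptional_point_near_1[OF m1(2)] by metis
  \<comment> \<open>A value strictly between 1 and \<open>d2\<close> puts the new point into an open
    interval and leaves room for the next one.\<close>
  obtain d where d: "1 < d" "d < d2" using dense[OF m2(2)] by blast
  have "d2 \<le> e" using t[of 1] by auto
  have "\<exists>T\<subseteq>{d<..<c}. finite T \<and> card T = Suc N \<and>
         (\<forall>t\<in>T. exceptional_point (of_rat (alpha (k * (m1 * m2)))) t)" if "0 < k" for k
  proof -
    obtain T' where T': "T' \<subseteq> {d1<..<c}" "finite T'" "card T' = N"
      "\<forall>t\<in>T'. exceptional_point (of_rat (alpha (k * (m1 * m2)))) t"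
      using T[of "k * m2"] \<open>0 < k\<close> m2(1) by (auto simp: mult_ac)
    obtain t' where t': "t' \<in> {d2..e}" "exceptional_point (of_rat (alpha (k * (m1 * m2)))) t'"
      using t[of "k * m1"] \<open>0 < k\<close> m1(1) by (auto simp: mult_ac)
    have "t' \<notin> T'" using T'(1) t'(1) m2(3) by force
    moreover have "insert t' T' \<subseteq> {d<..<c}"
      using T'(1) t'(1) d m1 m2 \<open>d2 \<le> e\<close> by force
    ultimately show ?thesis
      using T' t'(2) by (intro exI[of _ "insert t' T'"]) auto
  qed
  thus ?case using m1 m2 d \<open>d2 \<le> e\<close>
    by (intro exI[of _ "m1 * m2"] conjI exI[of _ d]) auto
qed

text \<open>The power of 5 in the denominator is coprime to the numerator and therefore determines
  \<open>n\<close>.\<close>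

lemma inj_alpha: "inj alpha"
proof (rule linorder_inj_onI)
  fix m n :: nat assume "m < n"
  show "alpha m \<noteq> alpha n"
  proof
    assume "alpha m = alpha n"
    hence "(of_nat (3 ^ num_exp m * 5 ^ n) :: rat) = of_nat (3 ^ num_exp n * 5 ^ m)"
      by (simp add: alpha_def field_simps)
    hence eq: "(3::nat) ^ num_exp m * 5 ^ n = 3 ^ num_exp n * 5 ^ m" by (simp only: of_nat_eq_iff)
    hence "(5::nat) ^ n dvd 3 ^ num_exp n * 5 ^ m" by (metis dvd_triv_right)
    hence "(5::nat) ^ n dvd 5 ^ m"
      using coprime_powers_3_5[of "num_exp n" n] by (simp add: coprime_dvd_mult_right_iff coprime_commute)
    hence "(5::nat) ^ n \<le> 5 ^ m" by (rule dvd_imp_le) simp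
    thus False using \<open>m < n\<close> by simp
  qed
qed auto

theorem theorem1p5:
  shows "infinite {q :: rat. q \<noteq> 0 \<and>
           (\<exists>T. finite T \<and> card T \<ge> 37 \<and> (\<forall>t\<in>T. exceptional_point (of_rat q) t))}"
    (is "infinite ?S")
proof -
  obtain m where m: "0 < m" "\<And>k. 0 < k \<Longrightarrow> \<exists>T. finite T \<and> card T = 37 \<and>
      (\<forall>t\<in>T. exceptional_point (of_rat (alpha (k * m))) t)"
    using many_exceptional_points[of 2 37] by (metis one_less_numeral_iff semiring_norm(76))
  \<comment> \<open>Every positive multiple of \<open>m\<close> gives a rational with 37 points; it
    remains to see that these rationals are distinct.\<close>
  have "inj (\<lambda>k. alpha (Suc k * m))"
  proof (rule injI)
    fix i j assume "alpha (Suc i * m) = alpha (Suc j * m)"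
    hence "Suc i * m = Suc j * m" by (rule injD[OF inj_alpha])
    thus "i = j" using m(1) by (simp only: mult_cancel2 nat.inject) auto
  qed
  hence "infinite (range (\<lambda>k. alpha (Suc k * m)))" by (rule range_inj_infinite)
  moreover have "range (\<lambda>k. alpha (Suc k * m)) \<subseteq> ?S"
  proof clarify
    fix k
    obtain T where "finite T" "card T = 37"
      "\<forall>t\<in>T. exceptional_point (of_rat (alpha (Suc k * m))) t" using m(2)[of "Suc k"] by auto
    thus "alpha (Suc k * m) \<noteq> 0 \<and> (\<exists>T. finite T \<and> card T \<ge> 37 \<and>
        (\<forall>t\<in>T. exceptional_point (of_rat (alpha (Suc k * m))) t))"
      by (intro conjI exI[of _ T]) (auto simp: alpha_def)
  qed
  ultimately show ?thesis by (rule infinite_super[rotated])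
qed

end
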